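(* Every finite product of orderly topological groups (with the product topology) is orderly.
   Context: The interval topology of a linearly ordered set has as subbase all rays $\{x: a<x\}$, $\{x: x<b\}$. A compact linearly ordered space is a linearly ordered set whose interval topology is compact, equipped with that topology. $H_+(K)$ is the group of all order-preserving homeomorphisms $K\to K$ with the compact-open topology. A topological group is orderly if it embeds as a topological group (injective homomorphism, homeomorphism onto its image) into $H_+(K)$ for some compact linearly ordered space $K$. *)

theory Defs
  imports "HOL-Analysis.Analysis" "HOL-Algebra.Bij" "HOL-Algebra.Product_Groups"
begin

definition topological_group :: "('a, 'b) monoid_scheme \<Rightarrow> 'a topology \<Rightarrow> bool" where
  "topological_group G T \<longleftrightarrow>
     group G \<and> topspace T = carrier G \<and>
     continuous_map (prod_topology T T) T (\<lambda>(x, y). x \<otimes>\<^bsub>G\<^esub> y) \<and>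
     continuous_map T T (\<lambda>x. inv\<^bsub>G\<^esub> x)"

(* The ordered set is a carrier K with a reflexive linear order r on K, so a < x is expressed by
   (a, x) \<in> r and a \<noteq> x.  K itself (the empty intersection of rays) is put into the generating
   family because topology_generated_by does not add it: the rays alone do not cover a
   one-point set. *)
definition interval_topology :: "'k set \<Rightarrow> 'k rel \<Rightarrow> 'k topology" where
  "interval_topology K r = topology_generated_by
     (insert K ({{x \<in> K. (a, x) \<in> r \<and> a \<noteq> x} | a. a \<in> K} \<union>
                {{x \<in> K. (x, b) \<in> r \<and> x \<noteq> b} | b. b \<in> K}))"

definition compact_linearly_ordered_space :: "'k set \<Rightarrow> 'k rel \<Rightarrow> bool" where
  "compact_linearly_ordered_space K r \<longleftrightarrow>
     linear_order_on K r \<and> compact_space (interval_topology K r)"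

(* As in BijGroup, self-maps of K are represented by functions that are extensional on K;
   the group operation is composition. *)
definition H_plus :: "'k set \<Rightarrow> 'k rel \<Rightarrow> ('k \<Rightarrow> 'k) monoid" where
  "H_plus K r = (BijGroup K)\<lparr>carrier :=
     {f \<in> extensional K.
        homeomorphic_map (interval_topology K r) (interval_topology K r) f \<and>
        monotone_on K (\<lambda>x y. (x, y) \<in> r) (\<lambda>x y. (x, y) \<in> r) f}\<rparr>"

(* The compact-open topology on a set F of maps from X to Y. *)
definition compact_open_topology ::
    "('x \<Rightarrow> 'y) set \<Rightarrow> 'x topology \<Rightarrow> 'y topology \<Rightarrow> ('x \<Rightarrow> 'y) topology" where
  "compact_open_topology F X Y = topology_generated_by
     {{f \<in> F. f ` C \<subseteq> U} | C U. compactin X C \<and> openin Y U}"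

definition H_plus_topology :: "'k set \<Rightarrow> 'k rel \<Rightarrow> ('k \<Rightarrow> 'k) topology" where
  "H_plus_topology K r =
     compact_open_topology (carrier (H_plus K r)) (interval_topology K r) (interval_topology K r)"

(* HOL cannot quantify over types inside a formula, so the type 'k from which the points of K
   are taken is an explicit parameter.  K ranges over arbitrary subsets of 'k with arbitrary linear
   orders, and a statement that is polymorphic in 'k covers compact linearly ordered spaces of
   every size. *)
definition orderly :: "'k itself \<Rightarrow> ('a, 'b) monoid_scheme \<Rightarrow> 'a topology \<Rightarrow> bool" where
  "orderly (_ :: 'k itself) G T \<longleftrightarrow>
     topological_group G T \<and>
     (\<exists>(K :: 'k set) r. compact_linearly_ordered_space K r \<and>
        (\<exists>h \<in> mon G (H_plus K r). embedding_map T (H_plus_topology K r) h))"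

lemma topspace_interval_topology: "topspace (interval_topology K r) = K"
  unfolding interval_topology_def topology_generated_by_topspace by blast

lemma topspace_H_plus_topology: "topspace (H_plus_topology K r) = carrier (H_plus K r)"
proof -
  have "carrier (H_plus K r) \<in> {{f \<in> carrier (H_plus K r). f ` C \<subseteq> U} | C U.
      compactin (interval_topology K r) C \<and> openin (interval_topology K r) U}"
    by (rule CollectI, rule exI[of _ "{}"], rule exI[of _ "{}"]) auto
  then show ?thesis
    unfolding H_plus_topology_def compact_open_topology_def topology_generated_by_topspace
    by blast
qed

end

theory Submission
  imports Defs
begin

text \<open>If every factor acts on a compact chain \<open>K\<^sub>i\<close>, the product acts on the ordered sum of the
  \<open>K\<^sub>i\<close>. Compact chains have end points, so every summand is clopen in the sum; hence a compact
  or open set of the sum is a disjoint union of compact or open sets of the summands, and the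
  compact-open topology of the glued maps is the product of those of the summands.
  The sum has to be placed in the same type \<open>'k\<close> as the \<open>K\<^sub>i\<close>. This is possible if \<open>'k\<close> is infinite;
  if \<open>'k\<close> is finite, all the groups are trivial, as a finite chain is rigid.\<close>

text \<open>The interval topology of an ordered sum need not be that of the disjoint union: if [0,
  1) is followed by [1, 2], the sum is [0, 2], and the second summand is not open in it. End points
  in the summands rule this out. Any numbering of the summands serves, since a glued map keeps every
  summand in place. An arbitrary automorphism of the sum, however, may move points from one summand
  to another, so the product of the groups is in general only a part of the automorphism group, and
  components can be recovered continuously only on the glued maps. Finiteness of \<open>I\<close>
  makes the union of the compact summands compact and turns one open condition per factor into an
  open condition on the product.\<close>

section \<open>Rays and continuity for interval topologies\<close>

lemma openin_interval_topology_above: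
  "a \<in> K \<Longrightarrow> openin (interval_topology K r) {x \<in> K. (a, x) \<in> r \<and> a \<noteq> x}"
  unfolding interval_topology_def by (rule topology_generated_by_Basis) blast

lemma openin_interval_topology_below:
  "b \<in> K \<Longrightarrow> openin (interval_topology K r) {x \<in> K. (x, b) \<in> r \<and> x \<noteq> b}"
  unfolding interval_topology_def by (rule topology_generated_by_Basis) blast

text \<open>Reversing the order swaps the two families of rays. Facts about greatest elements
  therefore dualize to least elements.\<close>

lemma interval_topology_converse: "interval_topology K (r\<inverse>) = interval_topology K r"
  unfolding interval_topology_def by (simp add: Un_commute eq_commute)

lemma continuous_map_interval_topologyI:
  assumes "\<And>x. x \<in> topspace X \<Longrightarrow> f x \<in> K"
    and "\<And>a. a \<in> K \<Longrightarrow> openin X {x \<in> topspace X. (a, f x) \<in> r \<and> a \<noteq> f x}"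
    and "\<And>b. b \<in> K \<Longrightarrow> openin X {x \<in> topspace X. (f x, b) \<in> r \<and> f x \<noteq> b}"
  shows "continuous_map X (interval_topology K r) f"
  unfolding interval_topology_def
proof (rule continuous_on_generated_topo)
  fix U
  assume U: "U \<in> insert K ({{x \<in> K. (a, x) \<in> r \<and> a \<noteq> x} |a. a \<in> K} \<union>
                {{x \<in> K. (x, b) \<in> r \<and> x \<noteq> b} |b. b \<in> K})"
  then consider "U = K" | a where "a \<in> K" "U = {x \<in> K. (a, x) \<in> r \<and> a \<noteq> x}"
    | b where "b \<in> K" "U = {x \<in> K. (x, b) \<in> r \<and> x \<noteq> b}"
    by blast
  then show "openin X (f -` U \<inter> topspace X)"
  proof cases
    case 1
    then have "f -` U \<inter> topspace X = topspace X" using assms(1) by auto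
    then show ?thesis by simp
  next
    case 2
    then have "f -` U \<inter> topspace X = {x \<in> topspace X. (a, f x) \<in> r \<and> a \<noteq> f x}"
      using assms(1) by auto
    then show ?thesis using assms(2) 2(1) by simp
  next
    case 3
    then have "f -` U \<inter> topspace X = {x \<in> topspace X. (f x, b) \<in> r \<and> f x \<noteq> b}"
      using assms(1) by auto
    then show ?thesis using assms(3) 3(1) by simp
  qed
qed (use assms(1) in auto)

section \<open>End points of compact chains\<close>

lemma linear_order_on_cases:
  "linear_order_on K r \<Longrightarrow> x \<in> K \<Longrightarrow> y \<in> K \<Longrightarrow> (x, y) \<in> r \<or> (y, x) \<in> r"
  unfolding linear_order_on_def partial_order_on_def preorder_on_def refl_on_def total_on_def
  by metis

lemma finite_linear_order_on_has_greatest: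
  assumes "linear_order_on K r" "finite B" "B \<noteq> {}" "B \<subseteq> K"
  obtains m where "m \<in> B" "\<And>b. b \<in> B \<Longrightarrow> (b, m) \<in> r"
proof -
  have tr: "trans r"
    using assms(1) by (simp add: linear_order_on_def partial_order_on_def preorder_on_def)
  note tot = linear_order_on_cases[OF assms(1)]
  from assms(2,3,4) have "\<exists>m\<in>B. \<forall>b\<in>B. (b, m) \<in> r"
  proof (induction rule: finite_ne_induct)
    case (singleton x)
    then show ?case using tot by blast
  next
    case (insert x F)
    then obtain m where m: "m \<in> F" "\<forall>b\<in>F. (b, m) \<in> r" by auto
    show ?case
    proof (cases "(x, m) \<in> r")
      case True
      with m show ?thesis by blast
    next
      case False
      with m tot[of x m] insert.prems have "(m, x) \<in> r" by blast
      with m tot[of x x] insert.prems have "\<forall>b\<in>insert x F. (b, x) \<in> r"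
        using transD[OF tr] by blast
      then show ?thesis by blast
    qed
  qed
  with that show ?thesis by blast
qed

text \<open>Without a greatest element every point lies strictly below another one, so the rays
  \<open>L b\<close> cover \<open>K\<close>. The greatest of the finitely many end points of a
  subcover would then lie strictly below one of those end points, which is impossible.\<close>

lemma compact_linearly_ordered_space_has_greatest:
  assumes "compact_linearly_ordered_space K r" "K \<noteq> {}"
  obtains m where "m \<in> K" "\<And>x. x \<in> K \<Longrightarrow> (x, m) \<in> r"
proof (rule ccontr)
  assume "\<not> thesis"
  with that have no_max: "\<forall>m\<in>K. \<exists>x\<in>K. (x, m) \<notin> r" by blast
  have lin: "linear_order_on K r" and comp: "compact_space (interval_topology K r)"
    using assms(1) by (auto simp: compact_linearly_ordered_space_def)
  have anti: "antisym r"
    using lin by (simp add: linear_order_on_def partial_order_on_def)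
  note tot = linear_order_on_cases[OF lin]
  define L where "L b = {x \<in> K. (x, b) \<in> r \<and> x \<noteq> b}" for b
  have "K \<subseteq> (\<Union>b\<in>K. L b)"
  proof
    fix x assume "x \<in> K"
    with no_max obtain b where "b \<in> K" "(b, x) \<notin> r" by blast
    then show "x \<in> (\<Union>b\<in>K. L b)" using tot \<open>x \<in> K\<close> by (auto simp: L_def)
  qed
  moreover have "\<forall>U\<in>L ` K. openin (interval_topology K r) U"
    using openin_interval_topology_below by (auto simp: L_def)
  moreover have "compactin (interval_topology K r) K"
    using comp by (simp add: compact_space_def topspace_interval_topology)
  ultimately obtain \<F> where "finite \<F>" "\<F> \<subseteq> L ` K" "K \<subseteq> \<Union>\<F>"
    unfolding compactin_def by (metis (no_types, lifting))
  then obtain B where B: "finite B" "B \<subseteq> K" "K \<subseteq> (\<Union>b\<in>B. L b)"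
    by (metis finite_subset_image)
  then have "B \<noteq> {}" using assms(2) by auto
  then obtain m where m: "m \<in> B" "\<And>b. b \<in> B \<Longrightarrow> (b, m) \<in> r"
    using finite_linear_order_on_has_greatest[OF lin B(1) _ B(2)] by blast
  then obtain b where "b \<in> B" "m \<in> L b" using B by blast
  then show False using m anti by (auto simp: L_def dest: antisymD)
qed

lemma compact_linearly_ordered_space_converse:
  "compact_linearly_ordered_space K (r\<inverse>) \<longleftrightarrow> compact_linearly_ordered_space K r"
  by (simp add: compact_linearly_ordered_space_def interval_topology_converse)

lemma compact_linearly_ordered_space_has_least:
  assumes "compact_linearly_ordered_space K r" "K \<noteq> {}"
  obtains m where "m \<in> K" "\<And>x. x \<in> K \<Longrightarrow> (m, x) \<in> r"
  using compact_linearly_ordered_space_has_greatest[of K "r\<inverse>"] assms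
  by (auto simp: compact_linearly_ordered_space_converse)

section \<open>The group \<open>H_plus\<close> and its compact-open topology\<close>

lemma in_carrier_H_plus:
  "f \<in> carrier (H_plus K r) \<longleftrightarrow> f \<in> extensional K \<and>
     homeomorphic_map (interval_topology K r) (interval_topology K r) f \<and>
     (\<forall>x\<in>K. \<forall>y\<in>K. (x, y) \<in> r \<longrightarrow> (f x, f y) \<in> r)"
  by (auto simp: H_plus_def monotone_on_def)

lemma carrier_H_plus_subset_Bij: "carrier (H_plus K r) \<subseteq> Bij K"
  unfolding subset_iff in_carrier_H_plus Bij_def bij_betw_def homeomorphic_eq_everything_map
    topspace_interval_topology by blast

text \<open>The multiplication inherited from \<open>BijGroup\<close> is specified as composition
  only on \<open>Bij K\<close>, so both factors must be known to lie there before it can be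
  unfolded.\<close>

lemma mult_H_plus:
  "f \<in> carrier (H_plus K r) \<Longrightarrow> g \<in> carrier (H_plus K r) \<Longrightarrow> f \<otimes>\<^bsub>H_plus K r\<^esub> g = compose K f g"
  using carrier_H_plus_subset_Bij[of K r] by (auto simp: H_plus_def BijGroup_def)

lemma H_plus_maps_to: "f \<in> carrier (H_plus K r) \<Longrightarrow> x \<in> K \<Longrightarrow> f x \<in> K"
  using carrier_H_plus_subset_Bij[of K r] Bij_imp_funcset by fastforce

lemma openin_H_plus_topology_subbase:
  assumes "compactin (interval_topology K r) C" "openin (interval_topology K r) U"
  shows "openin (H_plus_topology K r) {f \<in> carrier (H_plus K r). f ` C \<subseteq> U}"
  unfolding H_plus_topology_def compact_open_topology_def
  by (rule topology_generated_by_Basis) (use assms in blast)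

lemma continuous_map_H_plus_topologyI:
  assumes "\<And>x. x \<in> topspace X \<Longrightarrow> F x \<in> carrier (H_plus K r)"
    and "\<And>C U. compactin (interval_topology K r) C \<Longrightarrow> openin (interval_topology K r) U \<Longrightarrow>
           openin X {x \<in> topspace X. F x ` C \<subseteq> U}"
  shows "continuous_map X (H_plus_topology K r) F"
  unfolding H_plus_topology_def compact_open_topology_def
proof (rule continuous_on_generated_topo)
  fix V
  assume "V \<in> {{f \<in> carrier (H_plus K r). f ` C \<subseteq> U} |C U.
      compactin (interval_topology K r) C \<and> openin (interval_topology K r) U}"
  then obtain C U where V: "V = {f \<in> carrier (H_plus K r). f ` C \<subseteq> U}"
    and CU: "compactin (interval_topology K r) C" "openin (interval_topology K r) U"
    by blast
  have "F -` V \<inter> topspace X = {x \<in> topspace X. F x ` C \<subseteq> U}"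
    using V assms(1) by auto
  then show "openin X (F -` V \<inter> topspace X)" using assms(2)[OF CU] by simp
next
  \<comment> \<open>The space underlying a generated topology is the union of its generators, so the
    covering condition is just membership in the carrier.\<close>
  have "F ` topspace X \<subseteq> topspace (H_plus_topology K r)"
    using assms(1) by (auto simp: topspace_H_plus_topology)
  then show "F ` topspace X \<subseteq> \<Union>{{f \<in> carrier (H_plus K r). f ` C \<subseteq> U} |C U.
      compactin (interval_topology K r) C \<and> openin (interval_topology K r) U}"
    unfolding H_plus_topology_def compact_open_topology_def topology_generated_by_topspace .
qed

section \<open>Products of topological groups, and the trivial group\<close>

lemma topological_group_product:
  assumes "\<And>i. i \<in> I \<Longrightarrow> topological_group (G i) (T i)"
  shows "topological_group (product_group I G) (product_topology T I)"
proof -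
  have grp: "group (G i)" and top: "topspace (T i) = carrier (G i)"
    and mult: "continuous_map (prod_topology (T i) (T i)) (T i) (\<lambda>(x, y). x \<otimes>\<^bsub>G i\<^esub> y)"
    and inv: "continuous_map (T i) (T i) (\<lambda>x. inv\<^bsub>G i\<^esub> x)" if "i \<in> I" for i
    using assms[OF that] by (auto simp: topological_group_def)
  let ?P = "product_topology T I"
  have top_P: "topspace ?P = (\<Pi>\<^sub>E i\<in>I. carrier (G i))"
    using top by (auto simp: topspace_product_topology intro!: PiE_cong)
  have "continuous_map (prod_topology ?P ?P) ?P (\<lambda>p. \<lambda>i\<in>I. fst p i \<otimes>\<^bsub>G i\<^esub> snd p i)"
    unfolding continuous_map_componentwise
  proof (intro conjI ballI)
    fix i assume i: "i \<in> I"
    have "continuous_map (prod_topology ?P ?P) (prod_topology (T i) (T i)) (\<lambda>p. (fst p i, snd p i))"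
      by (intro continuous_map_pairedI
          continuous_map_compose[OF continuous_map_fst continuous_map_product_projection[OF i], unfolded o_def]
          continuous_map_compose[OF continuous_map_snd continuous_map_product_projection[OF i], unfolded o_def])
    from continuous_map_compose[OF this mult[OF i]]
    show "continuous_map (prod_topology ?P ?P) (T i) (\<lambda>p. (\<lambda>i\<in>I. fst p i \<otimes>\<^bsub>G i\<^esub> snd p i) i)"
      using i by (simp add: o_def)
  qed auto
  moreover have "continuous_map ?P ?P (\<lambda>x. inv\<^bsub>product_group I G\<^esub> x)"
  \<comment> \<open>The coordinatewise formula for the inverse is available only on the carrier;
    continuity is proved for the formula and then transferred.\<close>
  proof (rule continuous_map_eq)
    show "continuous_map ?P ?P (\<lambda>x. \<lambda>i\<in>I. inv\<^bsub>G i\<^esub> x i)"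
      unfolding continuous_map_componentwise
    proof (intro conjI ballI)
      fix i assume i: "i \<in> I"
      from continuous_map_compose[OF continuous_map_product_projection[of i I T, OF i] inv[OF i]] i
      show "continuous_map ?P (T i) (\<lambda>x. (\<lambda>i\<in>I. inv\<^bsub>G i\<^esub> x i) i)" by (simp add: o_def)
    qed auto
  next
    show "(\<lambda>i\<in>I. inv\<^bsub>G i\<^esub> x i) = inv\<^bsub>product_group I G\<^esub> x" if "x \<in> topspace ?P" for x
      using that inv_product_group[of x I G] grp unfolding top_P by simp
  qed
  ultimately show ?thesis
    using grp top_P by (simp add: topological_group_def case_prod_unfold)
qed

text \<open>The empty chain serves as \<open>K\<close>: it is compact, it is available in every
  type, and its only extensional self-map is the function that is \<open>undefined\<close>
  everywhere.\<close>

lemma orderly_trivial_group: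
  assumes "topological_group G T" "carrier G = {\<one>\<^bsub>G\<^esub>}"
  shows "orderly TYPE('k) G T"
proof -
  let ?e = "(\<lambda>_. undefined) :: 'k \<Rightarrow> 'k" and ?H = "H_plus ({} :: 'k set) {}"
  let ?X = "interval_topology ({} :: 'k set) {}" and ?HT = "H_plus_topology ({} :: 'k set) {}"
  have topX: "topspace ?X = {}"
    by (rule topspace_interval_topology)
  have "homeomorphic_map ?X ?X f" for f
    unfolding homeomorphic_map_maps homeomorphic_maps_def using topX
    by (simp add: continuous_map_def)
  then have car: "carrier ?H = {?e}"
    unfolding set_eq_iff in_carrier_H_plus by simp
  have one: "?e \<otimes>\<^bsub>?H\<^esub> ?e = ?e"
  proof -
    have "compose {} ?e ?e = ?e" by (simp add: compose_def)
    moreover have "?e \<in> carrier ?H" using car by (rule ssubst) (rule singletonI)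
    ultimately show ?thesis by (metis mult_H_plus)
  qed
  have T: "topspace T = {\<one>\<^bsub>G\<^esub>}" and grp: "group G"
    using assms by (auto simp: topological_group_def)
  have "compact_linearly_ordered_space ({} :: 'k set) {}"
    unfolding compact_linearly_ordered_space_def compact_space_def topX by simp
  moreover have "(\<lambda>_. ?e) \<in> mon G ?H"
    unfolding mon_def hom_def car assms(2) by (simp add: one)
  moreover have "embedding_map T ?HT (\<lambda>_. ?e)"
  proof -
    have "topspace (subtopology ?HT ((\<lambda>_. ?e) ` topspace T)) = {?e}"
      unfolding topspace_subtopology topspace_H_plus_topology car T by simp
    then have "homeomorphic_maps T (subtopology ?HT ((\<lambda>_. ?e) ` topspace T)) (\<lambda>_. ?e) (\<lambda>_. \<one>\<^bsub>G\<^esub>)"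
      unfolding homeomorphic_maps_def continuous_map_const T by simp
    then show ?thesis
      unfolding embedding_map_def by (rule homeomorphic_maps_map[THEN iffD1, THEN conjunct1])
  qed
  ultimately show ?thesis
    using assms(1) unfolding orderly_def by blast
qed

section \<open>The ordered sum of finitely many compact chains\<close>

text \<open>Preimages of compact sets under continuous maps need not be compact. Here
  \<open>f\<close> is a homeomorphism onto its image, and \<open>C\<close> lies in that image, so
  compactness transfers back.\<close>

lemma compactin_vimage_open_embedding:
  assumes "continuous_map X Y f" "inj_on f (topspace X)" "open_map X Y f"
    and C: "compactin Y C" "C \<subseteq> f ` topspace X"
  shows "compactin X {x \<in> topspace X. f x \<in> C}"
proof -
  have "homeomorphic_map X (subtopology Y (f ` topspace X)) f"
    using assms(1-3) by (simp add: injective_open_imp_embedding_map flip: embedding_map_def)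
  moreover have "f ` {x \<in> topspace X. f x \<in> C} = C"
    using C(2) by auto
  ultimately show ?thesis
    using C by (simp add: homeomorphic_map_compactness_eq compactin_subtopology)
qed

text \<open>The maps \<open>\<phi> i\<close> place the summands disjointly in a common type, kept
  abstract so that the sum can be studied before that type is chosen. The index type carries no
  order; the numbering \<open>e\<close> supplies one. Summands may be empty.\<close>

locale chain_sum =
  fixes I :: "'i set" and K :: "'i \<Rightarrow> 'k set" and r :: "'i \<Rightarrow> 'k rel"
    and \<phi> :: "'i \<Rightarrow> 'k \<Rightarrow> 'l" and e :: "'i \<Rightarrow> nat"
  assumes finite_I: "finite I"
    and inj_e: "inj_on e I"
    and \<phi>_eq_iff: "\<And>i j x y. i \<in> I \<Longrightarrow> j \<in> I \<Longrightarrow> x \<in> K i \<Longrightarrow> y \<in> K j \<Longrightarrow>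
           \<phi> i x = \<phi> j y \<longleftrightarrow> i = j \<and> x = y"
    and summand: "\<And>i. i \<in> I \<Longrightarrow> compact_linearly_ordered_space (K i) (r i)"
begin

abbreviation X :: "'i \<Rightarrow> 'k topology" where
  "X i \<equiv> interval_topology (K i) (r i)"

definition S :: "'l set" where
  "S = (\<Union>i\<in>I. \<phi> i ` K i)"

definition R :: "'l rel" where
  "R = {(\<phi> i x, \<phi> j y) |i j x y. i \<in> I \<and> j \<in> I \<and> x \<in> K i \<and> y \<in> K j \<and>
          (e i < e j \<or> i = j \<and> (x, y) \<in> r i)}"

abbreviation XS :: "'l topology" where
  "XS \<equiv> interval_topology S R"

lemma \<phi>_in_S: "i \<in> I \<Longrightarrow> x \<in> K i \<Longrightarrow> \<phi> i x \<in> S"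
  by (auto simp: S_def)

lemma S_cases:
  assumes "z \<in> S"
  obtains i x where "i \<in> I" "x \<in> K i" "z = \<phi> i x"
  using assms by (auto simp: S_def)

text \<open>Joint injectivity of the \<open>\<phi> i\<close> makes the index and the coordinate of a
  point of the sum unique, so the existential description of \<open>R\<close> can be read off the
  given coordinates.\<close>

lemma R_iff:
  assumes "i \<in> I" "j \<in> I" "x \<in> K i" "y \<in> K j"
  shows "(\<phi> i x, \<phi> j y) \<in> R \<longleftrightarrow> e i < e j \<or> i = j \<and> (x, y) \<in> r i"
proof
  assume "(\<phi> i x, \<phi> j y) \<in> R"
  then obtain i' j' x' y' where
    "\<phi> i x = \<phi> i' x'" "\<phi> j y = \<phi> j' y'" "i' \<in> I" "j' \<in> I" "x' \<in> K i'" "y' \<in> K j'"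
    "e i' < e j' \<or> i' = j' \<and> (x', y') \<in> r i'"
    unfolding R_def by blast
  with assms show "e i < e j \<or> i = j \<and> (x, y) \<in> r i"
    using \<phi>_eq_iff by metis
qed (use assms in \<open>auto simp: R_def\<close>)

lemma R_subset: "R \<subseteq> S \<times> S"
  by (auto simp: R_def S_def)

lemma linear_order_R: "linear_order_on S R"
proof -
  have lin: "linear_order_on (K i) (r i)" if "i \<in> I" for i
    using summand[OF that] by (simp add: compact_linearly_ordered_space_def)
  then have tr: "trans (r i)" and anti: "antisym (r i)" if "i \<in> I" for i
    using that by (simp_all add: linear_order_on_def partial_order_on_def preorder_on_def)
  have total: "(u, v) \<in> R \<or> (v, u) \<in> R" if "u \<in> S" "v \<in> S" for u v
    using that
  proof (elim S_cases)
    fix i x j y assume ij: "i \<in> I" "x \<in> K i" "u = \<phi> i x" "j \<in> I" "y \<in> K j" "v = \<phi> j y"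
    show ?thesis
    proof (cases "i = j")
      case True
      then show ?thesis
        using ij linear_order_on_cases[OF lin, of i x y] by (simp add: R_iff)
    next
      case False
      then have "e i < e j \<or> e j < e i"
        using ij inj_onD[OF inj_e] by (metis nat_neq_iff)
      then show ?thesis using ij by (auto simp: R_iff)
    qed
  qed
  have trans: "(u, w) \<in> R" if uv: "(u, v) \<in> R" and vw: "(v, w) \<in> R" for u v w
  proof -
    from uv vw R_subset have "u \<in> S" "v \<in> S" "w \<in> S" by auto
    then show ?thesis
    proof (elim S_cases)
      fix i x j y k z
      assume ijk: "i \<in> I" "x \<in> K i" "u = \<phi> i x" "j \<in> I" "y \<in> K j" "v = \<phi> j y"
        "k \<in> I" "z \<in> K k" "w = \<phi> k z"
      from uv vw have "e i < e j \<or> i = j \<and> (x, y) \<in> r i" "e j < e k \<or> j = k \<and> (y, z) \<in> r j"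
        using ijk by (simp_all add: R_iff)
      then have "e i < e k \<or> i = k \<and> (x, z) \<in> r i"
        using tr ijk(1) transD less_trans by metis
      then show ?thesis using ijk by (simp add: R_iff)
    qed
  qed
  have antisym: "u = v" if uv: "(u, v) \<in> R" and vu: "(v, u) \<in> R" for u v
  proof -
    from uv R_subset have "u \<in> S" "v \<in> S" by auto
    then show ?thesis
    proof (elim S_cases)
      fix i x j y assume ij: "i \<in> I" "x \<in> K i" "u = \<phi> i x" "j \<in> I" "y \<in> K j" "v = \<phi> j y"
      then show ?thesis
        using uv vu antisymD[OF anti] by (auto simp: R_iff)
    qed
  qed
  show ?thesis
    unfolding linear_order_on_def partial_order_on_def preorder_on_def refl_on_def total_on_def
    using R_subset total antisym trans by (blast intro: antisymI transI)
qed

text \<open>A ray of the sum meets a summand in everything, in nothing or in a ray of that summand,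
  according to whether its end point lies in a summand on the one side, on the other side, or in
  this very summand.\<close>

lemma continuous_map_\<phi>:
  assumes i: "i \<in> I"
  shows "continuous_map (X i) XS (\<phi> i)"
proof (rule continuous_map_interval_topologyI)
  fix a assume "a \<in> S"
  then show "openin (X i) {x \<in> topspace (X i). (a, \<phi> i x) \<in> R \<and> a \<noteq> \<phi> i x}"
  proof (rule S_cases)
    fix j y assume j: "j \<in> I" "y \<in> K j" "a = \<phi> j y"
    consider "e j < e i" | "j = i" | "e i < e j"
      using i j inj_onD[OF inj_e] by (metis nat_neq_iff)
    then show ?thesis
    proof cases
      case 1
      then have "{x \<in> topspace (X i). (a, \<phi> i x) \<in> R \<and> a \<noteq> \<phi> i x} = topspace (X i)"
        using i j by (auto simp: topspace_interval_topology R_iff \<phi>_eq_iff)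
      then show ?thesis by simp
    next
      case 2
      then have "{x \<in> topspace (X i). (a, \<phi> i x) \<in> R \<and> a \<noteq> \<phi> i x} = {x \<in> K i. (y, x) \<in> r i \<and> y \<noteq> x}"
        using i j by (auto simp: topspace_interval_topology R_iff \<phi>_eq_iff)
      then show ?thesis using openin_interval_topology_above[of y "K i" "r i"] 2 j by simp
    next
      case 3
      then have "{x \<in> topspace (X i). (a, \<phi> i x) \<in> R \<and> a \<noteq> \<phi> i x} = {}"
        using i j by (auto simp: topspace_interval_topology R_iff \<phi>_eq_iff)
      then show ?thesis by (metis openin_empty)
    qed
  qed
next
  fix b assume "b \<in> S"
  then show "openin (X i) {x \<in> topspace (X i). (\<phi> i x, b) \<in> R \<and> \<phi> i x \<noteq> b}"
  proof (rule S_cases)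
    fix j y assume j: "j \<in> I" "y \<in> K j" "b = \<phi> j y"
    consider "e i < e j" | "j = i" | "e j < e i"
      using i j inj_onD[OF inj_e] by (metis nat_neq_iff)
    then show ?thesis
    proof cases
      case 1
      then have "{x \<in> topspace (X i). (\<phi> i x, b) \<in> R \<and> \<phi> i x \<noteq> b} = topspace (X i)"
        using i j by (auto simp: topspace_interval_topology R_iff \<phi>_eq_iff)
      then show ?thesis by simp
    next
      case 2
      then have "{x \<in> topspace (X i). (\<phi> i x, b) \<in> R \<and> \<phi> i x \<noteq> b} = {x \<in> K i. (x, y) \<in> r i \<and> x \<noteq> y}"
        using i j by (auto simp: topspace_interval_topology R_iff \<phi>_eq_iff)
      then show ?thesis using openin_interval_topology_below[of y "K i" "r i"] 2 j by simp
    next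
      case 3
      then have "{x \<in> topspace (X i). (\<phi> i x, b) \<in> R \<and> \<phi> i x \<noteq> b} = {}"
        using i j by (auto simp: topspace_interval_topology R_iff \<phi>_eq_iff)
      then show ?thesis by (metis openin_empty)
    qed
  qed
qed (use i \<phi>_in_S in \<open>auto simp: topspace_interval_topology\<close>)

text \<open>A summand is open because, by compactness, every other summand lies entirely below its
  greatest or above its least element.\<close>
lemma openin_summand:
  assumes i: "i \<in> I"
  shows "openin XS (\<phi> i ` K i)"
proof -
  have "\<exists>U. openin XS U \<and> \<phi> i ` K i \<subseteq> U \<and> U \<inter> \<phi> j ` K j = {}" if j: "j \<in> I - {i}" for j
  proof (cases "K j = {}")
    \<comment> \<open>An empty summand has no end point to cut at, but all of \<open>S\<close>
      already misses it.\<close>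
    case True
    moreover have "openin XS S"
      using openin_topspace[of XS] by (simp add: topspace_interval_topology)
    ultimately show ?thesis using i \<phi>_in_S by blast
  next
    case False
    have ne: "i \<noteq> j" "j \<in> I" using j by auto
    then have "e j < e i \<or> e i < e j"
      using i inj_onD[OF inj_e] by (metis nat_neq_iff)
    then show ?thesis
    proof
      assume e: "e j < e i"
      obtain m where m: "m \<in> K j" "\<And>x. x \<in> K j \<Longrightarrow> (x, m) \<in> r j"
        using compact_linearly_ordered_space_has_greatest[OF summand[OF ne(2)] False] by metis
      let ?U = "{z \<in> S. (\<phi> j m, z) \<in> R \<and> \<phi> j m \<noteq> z}"
      have "z \<notin> ?U" if "z \<in> \<phi> j ` K j" for z
      proof
        assume z: "z \<in> ?U"
        from that obtain x where x: "x \<in> K j" "z = \<phi> j x" by blast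
        with m ne have "(z, \<phi> j m) \<in> R" by (simp add: R_iff)
        with z linear_order_R show False
          by (auto simp: linear_order_on_def partial_order_on_def dest: antisymD)
      qed
      moreover have "\<phi> i ` K i \<subseteq> ?U"
        using i ne m e by (auto simp: R_iff \<phi>_eq_iff \<phi>_in_S)
      moreover have "openin XS ?U"
        using \<phi>_in_S[OF ne(2) m(1)] by (rule openin_interval_topology_above)
      ultimately show ?thesis by blast
    next
      assume e: "e i < e j"
      obtain m where m: "m \<in> K j" "\<And>x. x \<in> K j \<Longrightarrow> (m, x) \<in> r j"
        using compact_linearly_ordered_space_has_least[OF summand[OF ne(2)] False] by metis
      let ?U = "{z \<in> S. (z, \<phi> j m) \<in> R \<and> z \<noteq> \<phi> j m}"
      have "z \<notin> ?U" if "z \<in> \<phi> j ` K j" for z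
      proof
        assume z: "z \<in> ?U"
        from that obtain x where x: "x \<in> K j" "z = \<phi> j x" by blast
        with m ne have "(\<phi> j m, z) \<in> R" by (simp add: R_iff)
        with z linear_order_R show False
          by (auto simp: linear_order_on_def partial_order_on_def dest: antisymD)
      qed
      moreover have "\<phi> i ` K i \<subseteq> ?U"
        using i ne m e by (auto simp: R_iff \<phi>_eq_iff \<phi>_in_S)
      moreover have "openin XS ?U"
        using \<phi>_in_S[OF ne(2) m(1)] by (rule openin_interval_topology_below)
      ultimately show ?thesis by blast
    qed
  qed
  then obtain U where U: "\<And>j. j \<in> I - {i} \<Longrightarrow> openin XS (U j)"
    "\<And>j. j \<in> I - {i} \<Longrightarrow> \<phi> i ` K i \<subseteq> U j" "\<And>j. j \<in> I - {i} \<Longrightarrow> U j \<inter> \<phi> j ` K j = {}"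
    by metis
  \<comment> \<open>If \<open>i\<close> is the only index, the intersection of the
    \<open>U j\<close> is the whole type; the factor \<open>S\<close> brings it back into the
    space.\<close>
  have "(\<Inter>j\<in>I - {i}. U j) \<inter> S = \<phi> i ` K i"
  proof (intro subset_antisym subsetI)
    fix z assume z: "z \<in> (\<Inter>j\<in>I - {i}. U j) \<inter> S"
    then obtain j x where "j \<in> I" "x \<in> K j" "z = \<phi> j x" by (blast elim: S_cases)
    with z U(3)[of j] show "z \<in> \<phi> i ` K i" by (cases "j = i") auto
  qed (use U(2) i in \<open>auto simp: S_def\<close>)
  with openin_INT[of "I - {i}" XS U] U(1) finite_I show ?thesis
    by (simp add: topspace_interval_topology)
qed

lemma inj_on_\<phi>: "i \<in> I \<Longrightarrow> inj_on (\<phi> i) (K i)"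
  by (auto simp: inj_on_def \<phi>_eq_iff)

text \<open>The image of a ray of \<open>K i\<close> is the trace of a ray of the sum on the
  summand, which is open. Images commute with unions always and with intersections by injectivity,
  so the subbase decides.\<close>

lemma open_map_\<phi>:
  assumes i: "i \<in> I"
  shows "open_map (X i) XS (\<phi> i)"
  unfolding open_map_def
proof (intro allI impI)
  fix U assume "openin (X i) U"
  then have "generate_topology_on
     (insert (K i) ({{x \<in> K i. (a, x) \<in> r i \<and> a \<noteq> x} |a. a \<in> K i} \<union>
                {{x \<in> K i. (x, b) \<in> r i \<and> x \<noteq> b} |b. b \<in> K i})) U"
    unfolding interval_topology_def by (rule openin_topology_generated_by)
  \<comment> \<open>The first conjunct strengthens the induction: \<open>\<phi> i\<close> is known
    to be injective only on \<open>K i\<close>, and the intersection case relies on that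
    injectivity.\<close>
  then have "U \<subseteq> K i \<and> openin XS (\<phi> i ` U)"
  proof induction
    case (Int a b)
    then have "\<phi> i ` (a \<inter> b) = \<phi> i ` a \<inter> \<phi> i ` b"
      using inj_on_image_Int[OF inj_on_\<phi>[OF i]] by blast
    with Int show ?case by (auto intro: openin_Int)
  next
    case (UN \<K>)
    have "openin XS (\<Union>((`) (\<phi> i) ` \<K>))"
      using UN by (intro openin_Union) blast
    then have "openin XS (\<phi> i ` \<Union>\<K>)" by (simp only: image_Union)
    with UN show ?case by blast
  next
    case (Basis s)
    then consider "s = K i" | a where "a \<in> K i" "s = {x \<in> K i. (a, x) \<in> r i \<and> a \<noteq> x}"
      | b where "b \<in> K i" "s = {x \<in> K i. (x, b) \<in> r i \<and> x \<noteq> b}"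
      by blast
    then show ?case
    proof cases
      case 1
      then show ?thesis using openin_summand[OF i] by simp
    next
      case 2
      then have "\<phi> i ` s = \<phi> i ` K i \<inter> {z \<in> S. (\<phi> i a, z) \<in> R \<and> \<phi> i a \<noteq> z}"
        using i by (auto simp: R_iff \<phi>_eq_iff \<phi>_in_S)
      then show ?thesis
        using 2 openin_Int[OF openin_summand[OF i] openin_interval_topology_above[OF \<phi>_in_S[OF i 2(1)]]]
        by auto
    next
      case 3
      then have "\<phi> i ` s = \<phi> i ` K i \<inter> {z \<in> S. (z, \<phi> i b) \<in> R \<and> z \<noteq> \<phi> i b}"
        using i by (auto simp: R_iff \<phi>_eq_iff \<phi>_in_S)
      then show ?thesis
        using 3 openin_Int[OF openin_summand[OF i] openin_interval_topology_below[OF \<phi>_in_S[OF i 3(1)]]]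
        by auto
    qed
  qed simp
  then show "openin XS (\<phi> i ` U)" by blast
qed

lemma compactin_summand: "i \<in> I \<Longrightarrow> compactin XS (\<phi> i ` K i)"
  using image_compactin[OF _ continuous_map_\<phi>, of i "K i"] summand
  by (simp add: compact_linearly_ordered_space_def compact_space_def topspace_interval_topology)

lemma compact_linearly_ordered_sum: "compact_linearly_ordered_space S R"
proof -
  have "compactin XS (\<Union>i\<in>I. \<phi> i ` K i)"
    using compactin_summand finite_I by (intro compactin_Union) auto
  then show ?thesis
    using linear_order_R
    by (simp add: compact_linearly_ordered_space_def compact_space_def topspace_interval_topology
        flip: S_def)
qed

lemma closedin_summand:
  assumes i: "i \<in> I"
  shows "closedin XS (\<phi> i ` K i)"
proof -
  have "S - \<phi> i ` K i = (\<Union>j\<in>I - {i}. \<phi> j ` K j)"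
    using i by (auto simp: S_def \<phi>_eq_iff)
  moreover have "openin XS (\<Union>j\<in>I - {i}. \<phi> j ` K j)"
    using openin_summand by (intro openin_Union) auto
  ultimately show ?thesis
    using i by (auto simp: closedin_def topspace_interval_topology \<phi>_in_S)
qed

text \<open>Both halves of clopenness enter: the summand is closed, so its intersection with
  \<open>C\<close> is compact, and \<open>\<phi> i\<close> is an open embedding, so this compact set
  can be pulled back to \<open>K i\<close>.\<close>

lemma compactin_vimage_summand:
  assumes i: "i \<in> I" and C: "compactin XS C"
  shows "compactin (X i) {x \<in> K i. \<phi> i x \<in> C}"
proof -
  have "compactin XS (\<phi> i ` K i \<inter> C)"
    using closedin_summand[OF i] C by (rule closed_Int_compactin)
  then have "compactin (X i) {x \<in> topspace (X i). \<phi> i x \<in> \<phi> i ` K i \<inter> C}"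
    using i by (intro compactin_vimage_open_embedding[OF continuous_map_\<phi> _ open_map_\<phi>])
      (auto simp: topspace_interval_topology inj_on_\<phi>)
  moreover have "{x \<in> topspace (X i). \<phi> i x \<in> \<phi> i ` K i \<inter> C} = {x \<in> K i. \<phi> i x \<in> C}"
    by (auto simp: topspace_interval_topology)
  ultimately show ?thesis by simp
qed

lemma openin_vimage_summand:
  "i \<in> I \<Longrightarrow> openin XS U \<Longrightarrow> openin (X i) {x \<in> K i. \<phi> i x \<in> U}"
  using openin_continuous_map_preimage[OF continuous_map_\<phi>, of i U]
  by (simp add: topspace_interval_topology)

lemma openin_sumI:
  assumes "U \<subseteq> S" "\<And>i. i \<in> I \<Longrightarrow> openin (X i) {x \<in> K i. \<phi> i x \<in> U}"
  shows "openin XS U"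
proof -
  have "openin XS (\<Union>i\<in>I. \<phi> i ` {x \<in> K i. \<phi> i x \<in> U})"
    using assms(2) open_map_\<phi> by (intro openin_Union) (auto simp: open_map_def)
  moreover have "(\<Union>i\<in>I. \<phi> i ` {x \<in> K i. \<phi> i x \<in> U}) = U"
    using assms(1) unfolding S_def by blast
  ultimately show ?thesis by simp
qed

section \<open>Gluing maps of the summands\<close>

text \<open>The description is proper because coordinates in the sum are unique. Restriction to
  \<open>S\<close> yields the extensional representative that the carrier of
  \<open>H_plus S R\<close> requires.\<close>

definition glue :: "('i \<Rightarrow> 'k \<Rightarrow> 'k) \<Rightarrow> 'l \<Rightarrow> 'l" where
  "glue F = (\<lambda>z\<in>S. THE w. \<exists>i\<in>I. \<exists>x\<in>K i. z = \<phi> i x \<and> w = \<phi> i (F i x))"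

lemma glue_\<phi> [simp]:
  assumes "i \<in> I" "x \<in> K i"
  shows "glue F (\<phi> i x) = \<phi> i (F i x)"
proof -
  have "(THE w. \<exists>j\<in>I. \<exists>y\<in>K j. \<phi> i x = \<phi> j y \<and> w = \<phi> j (F j y)) = \<phi> i (F i x)"
    using assms by (intro the_equality) (metis \<phi>_eq_iff)+
  with assms show ?thesis by (simp add: glue_def \<phi>_in_S)
qed

text \<open>Openness in the sum can be tested on each summand separately, and there the glued map
  acts as \<open>F i\<close>.\<close>

lemma continuous_map_glue:
  assumes "\<And>i. i \<in> I \<Longrightarrow> continuous_map (X i) (X i) (F i)"
  shows "continuous_map XS XS (glue F)"
  unfolding continuous_map
proof (intro conjI allI impI)
  have F: "F i x \<in> K i" if "i \<in> I" "x \<in> K i" for i x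
    using continuous_map_image_subset_topspace[OF assms[OF that(1)]] that(2)
    by (auto simp: topspace_interval_topology)
  show "glue F ` topspace XS \<subseteq> topspace XS"
    using F by (auto simp: topspace_interval_topology \<phi>_in_S elim!: S_cases)
  fix U assume U: "openin XS U"
  show "openin XS {z \<in> topspace XS. glue F z \<in> U}"
  proof (rule openin_sumI)
    fix i assume i: "i \<in> I"
    have "openin (X i) {x \<in> topspace (X i). F i x \<in> {x \<in> K i. \<phi> i x \<in> U}}"
      using assms[OF i] openin_vimage_summand[OF i U] by (rule openin_continuous_map_preimage)
    moreover have "{x \<in> topspace (X i). F i x \<in> {x \<in> K i. \<phi> i x \<in> U}} =
        {x \<in> K i. \<phi> i x \<in> {z \<in> topspace XS. glue F z \<in> U}}"
      using i F by (auto simp: topspace_interval_topology \<phi>_in_S)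
    ultimately show "openin (X i) {x \<in> K i. \<phi> i x \<in> {z \<in> topspace XS. glue F z \<in> U}}"
      by simp
  qed (auto simp: topspace_interval_topology)
qed

text \<open>Gluing the inverses gives a continuous inverse. Points of different summands keep their
  order because no summand is left; within one summand monotonicity of \<open>F i\<close>
  applies.\<close>

lemma glue_in_H_plus:
  assumes "\<And>i. i \<in> I \<Longrightarrow> F i \<in> carrier (H_plus (K i) (r i))"
  shows "glue F \<in> carrier (H_plus S R)"
proof -
  have "\<exists>g. homeomorphic_maps (X i) (X i) (F i) g" if "i \<in> I" for i
    using assms[OF that] by (simp add: in_carrier_H_plus homeomorphic_map_maps)
  then obtain g where g: "\<And>i. i \<in> I \<Longrightarrow> homeomorphic_maps (X i) (X i) (F i) (g i)"
    by metis
  then have into: "F i x \<in> K i" "g i x \<in> K i" and inv: "g i (F i x) = x" "F i (g i x) = x"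
    if "i \<in> I" "x \<in> K i" for i x
    using that continuous_map_image_subset_topspace[of "X i" "X i"]
    by (fastforce simp: homeomorphic_maps_def topspace_interval_topology)+
  have "homeomorphic_maps XS XS (glue F) (glue g)"
    unfolding homeomorphic_maps_def
  proof (intro conjI ballI)
    show "continuous_map XS XS (glue F)" "continuous_map XS XS (glue g)"
      using g by (auto intro!: continuous_map_glue simp: homeomorphic_maps_def)
    fix z assume "z \<in> topspace XS"
    then show "glue g (glue F z) = z" "glue F (glue g z) = z"
      using into inv by (auto simp: topspace_interval_topology elim!: S_cases)
  qed
  moreover have "(glue F u, glue F v) \<in> R" if "(u, v) \<in> R" "u \<in> S" "v \<in> S" for u v
    using that(2,3)
  proof (elim S_cases)
    fix i x j y assume ij: "i \<in> I" "x \<in> K i" "u = \<phi> i x" "j \<in> I" "y \<in> K j" "v = \<phi> j y"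
    with that(1) have "e i < e j \<or> i = j \<and> (x, y) \<in> r i" by (simp add: R_iff)
    then have "e i < e j \<or> i = j \<and> (F i x, F i y) \<in> r i"
      using assms[of i] ij by (auto simp: in_carrier_H_plus)
    then show ?thesis using ij into by (auto simp: R_iff)
  qed
  moreover have "glue F \<in> extensional S"
    by (simp add: glue_def)
  ultimately show ?thesis
    by (auto simp: in_carrier_H_plus homeomorphic_map_maps)
qed

text \<open>Since \<open>F' i\<close> maps \<open>K i\<close> into itself, the outer gluing is
  evaluated in the same summand and uses the matching \<open>F i\<close>.\<close>

lemma glue_compose:
  assumes "\<And>i. i \<in> I \<Longrightarrow> F' i \<in> carrier (H_plus (K i) (r i))"
  shows "glue (\<lambda>i. compose (K i) (F i) (F' i)) = compose S (glue F) (glue F')"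
proof
  fix z
  show "glue (\<lambda>i. compose (K i) (F i) (F' i)) z = compose S (glue F) (glue F') z"
  proof (cases "z \<in> S")
    case True
    then show ?thesis
      using H_plus_maps_to[OF assms] by (auto simp: compose_def \<phi>_in_S elim!: S_cases)
  qed (simp add: glue_def compose_def)
qed

lemma glue_cong: "(\<And>i. i \<in> I \<Longrightarrow> F i = F' i) \<Longrightarrow> glue F = glue F'"
  unfolding glue_def by (intro restrict_ext arg_cong[of _ _ The]) auto

text \<open>This is the i-th component of \<open>f\<close>, a left inverse to gluing. It is
  meaningful only if \<open>f\<close> preserves the i-th summand; elsewhere \<open>inv_into\<close>
  returns unspecified values.\<close>

definition summand_map :: "'i \<Rightarrow> ('l \<Rightarrow> 'l) \<Rightarrow> 'k \<Rightarrow> 'k" where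
  "summand_map i f = (\<lambda>x\<in>K i. inv_into (K i) (\<phi> i) (f (\<phi> i x)))"

lemma summand_map_glue:
  assumes "i \<in> I" "F i \<in> carrier (H_plus (K i) (r i))"
  shows "summand_map i (glue F) = F i"
proof
  fix x
  show "summand_map i (glue F) x = F i x"
    using assms H_plus_maps_to[OF assms(2)] inj_on_\<phi>[OF assms(1)]
    by (cases "x \<in> K i") (auto simp: summand_map_def in_carrier_H_plus extensional_def)
qed

section \<open>The compact-open topology on glued maps\<close>

text \<open>A glued map sends \<open>C\<close> into \<open>U\<close> iff every component sends the
  trace of \<open>C\<close> on its summand into the trace of \<open>U\<close>. The traces are
  compact and open, so each of these finitely many conditions is subbasic in its factor.\<close>

lemma continuous_map_glue_H_plus:
  assumes "\<And>i. i \<in> I \<Longrightarrow> continuous_map Y (H_plus_topology (K i) (r i)) (F i)"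
  shows "continuous_map Y (H_plus_topology S R) (\<lambda>y. glue (\<lambda>i. F i y))"
proof (rule continuous_map_H_plus_topologyI)
  have F: "F i y \<in> carrier (H_plus (K i) (r i))" if "i \<in> I" "y \<in> topspace Y" for i y
    using continuous_map_image_subset_topspace[OF assms[OF that(1)]] that(2)
    by (auto simp: topspace_H_plus_topology)
  then show "glue (\<lambda>i. F i y) \<in> carrier (H_plus S R)" if "y \<in> topspace Y" for y
    using that by (intro glue_in_H_plus)
  fix C U assume C: "compactin XS C" and U: "openin XS U"
  have "C \<subseteq> S"
    using compactin_subset_topspace[OF C] by (simp add: topspace_interval_topology)
  define W where "W i = {y \<in> topspace Y. F i y ` {x \<in> K i. \<phi> i x \<in> C} \<subseteq> {x \<in> K i. \<phi> i x \<in> U}}" for i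
  have "openin Y (W i)" if i: "i \<in> I" for i
  proof -
    have "openin Y {y \<in> topspace Y. F i y \<in> {f \<in> carrier (H_plus (K i) (r i)).
        f ` {x \<in> K i. \<phi> i x \<in> C} \<subseteq> {x \<in> K i. \<phi> i x \<in> U}}}"
      using assms[OF i] openin_H_plus_topology_subbase[OF compactin_vimage_summand[OF i C]
          openin_vimage_summand[OF i U]]
      by (rule openin_continuous_map_preimage)
    moreover have "{y \<in> topspace Y. F i y \<in> {f \<in> carrier (H_plus (K i) (r i)).
        f ` {x \<in> K i. \<phi> i x \<in> C} \<subseteq> {x \<in> K i. \<phi> i x \<in> U}}} = W i"
      using F i by (auto simp: W_def)
    ultimately show ?thesis by simp
  qed
  \<comment> \<open>The factor \<open>topspace Y\<close> takes care of an empty \<open>I\<close>,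
    where the intersection of the \<open>W i\<close> is the whole type.\<close>
  then have "openin Y ((\<Inter>i\<in>I. W i) \<inter> topspace Y)"
    using finite_I by (intro openin_INT)
  moreover have "{y \<in> topspace Y. glue (\<lambda>i. F i y) ` C \<subseteq> U} = (\<Inter>i\<in>I. W i) \<inter> topspace Y"
  proof (intro subset_antisym subsetI)
    fix y assume y: "y \<in> {y \<in> topspace Y. glue (\<lambda>i. F i y) ` C \<subseteq> U}"
    have "F i y x \<in> {x \<in> K i. \<phi> i x \<in> U}" if "i \<in> I" "x \<in> K i" "\<phi> i x \<in> C" for i x
    proof -
      have "glue (\<lambda>i. F i y) (\<phi> i x) \<in> U" using y that(3) by blast
      then show ?thesis using that y H_plus_maps_to[OF F] by simp
    qed
    with y show "y \<in> (\<Inter>i\<in>I. W i) \<inter> topspace Y"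
      by (auto simp: W_def)
  next
    fix y assume y: "y \<in> (\<Inter>i\<in>I. W i) \<inter> topspace Y"
    have "glue (\<lambda>i. F i y) z \<in> U" if z: "z \<in> C" for z
    proof -
      from z \<open>C \<subseteq> S\<close> obtain i x where ix: "i \<in> I" "x \<in> K i" "z = \<phi> i x" by (blast elim: S_cases)
      with y z have "F i y x \<in> {x \<in> K i. \<phi> i x \<in> U}" unfolding W_def by blast
      with ix show ?thesis by simp
    qed
    with y show "y \<in> {y \<in> topspace Y. glue (\<lambda>i. F i y) ` C \<subseteq> U}" by blast
  qed
  ultimately show "openin Y {y \<in> topspace Y. glue (\<lambda>i. F i y) ` C \<subseteq> U}" by simp
qed

text \<open>In general these are not all elements of \<open>H_plus S R\<close>: if the chain of
  integers with both infinities is cut between 0 and 1 into two compact summands, the shift moves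
  the cut. Continuity of the components is therefore stated on this subspace.\<close>

definition glued_maps :: "('l \<Rightarrow> 'l) set" where
  "glued_maps = {glue F |F. \<forall>i\<in>I. F i \<in> carrier (H_plus (K i) (r i))}"

text \<open>For a glued \<open>f\<close>, the i-th component sends \<open>C\<close> into
  \<open>U\<close> iff \<open>f\<close> sends the image of \<open>C\<close> under
  \<open>\<phi> i\<close> into the image of \<open>U\<close>. The first image is compact by
  continuity of \<open>\<phi> i\<close>, the second open because \<open>\<phi> i\<close> is an open
  map.\<close>

lemma continuous_map_summand_map:
  assumes i: "i \<in> I"
  shows "continuous_map (subtopology (H_plus_topology S R) glued_maps)
           (H_plus_topology (K i) (r i)) (summand_map i)"
proof (rule continuous_map_H_plus_topologyI)
  have top: "topspace (subtopology (H_plus_topology S R) glued_maps) = glued_maps"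
    using glue_in_H_plus by (auto simp: topspace_H_plus_topology glued_maps_def)
  fix f assume "f \<in> topspace (subtopology (H_plus_topology S R) glued_maps)"
  then show "summand_map i f \<in> carrier (H_plus (K i) (r i))"
    unfolding top using i by (auto simp: glued_maps_def summand_map_glue)
next
  have top: "topspace (subtopology (H_plus_topology S R) glued_maps) = glued_maps"
    using glue_in_H_plus by (auto simp: topspace_H_plus_topology glued_maps_def)
  fix C U assume C: "compactin (X i) C" and U: "openin (X i) U"
  have CK: "C \<subseteq> K i" and UK: "U \<subseteq> K i"
    using compactin_subset_topspace[OF C] openin_subset[OF U]
    by (auto simp: topspace_interval_topology)
  have "openin XS (\<phi> i ` U)"
    using open_map_\<phi>[OF i] U by (simp add: open_map_def)
  then have "openin (H_plus_topology S R) {f \<in> carrier (H_plus S R). f ` \<phi> i ` C \<subseteq> \<phi> i ` U}"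
    using image_compactin[OF C continuous_map_\<phi>[OF i]] by (intro openin_H_plus_topology_subbase)
  then have "openin (subtopology (H_plus_topology S R) glued_maps)
      ({f \<in> carrier (H_plus S R). f ` \<phi> i ` C \<subseteq> \<phi> i ` U} \<inter> glued_maps)"
    by (auto simp: openin_subtopology)
  moreover have "{f \<in> carrier (H_plus S R). f ` \<phi> i ` C \<subseteq> \<phi> i ` U} \<inter> glued_maps =
      {f \<in> glued_maps. summand_map i f ` C \<subseteq> U}"
  proof -
    have "f ` \<phi> i ` C \<subseteq> \<phi> i ` U \<longleftrightarrow> summand_map i f ` C \<subseteq> U" if "f \<in> glued_maps" for f
    proof -
      from that obtain F where F: "f = glue F" "\<forall>i\<in>I. F i \<in> carrier (H_plus (K i) (r i))"
        by (auto simp: glued_maps_def)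
      have "f (\<phi> i x) \<in> \<phi> i ` U \<longleftrightarrow> summand_map i f x \<in> U" if "x \<in> C" for x
      proof -
        have Fi: "F i \<in> carrier (H_plus (K i) (r i))" using F(2) i by blast
        have x: "x \<in> K i" using that CK by blast
        have "\<phi> i (F i x) \<in> \<phi> i ` U \<longleftrightarrow> F i x \<in> U"
          using inj_on_image_mem_iff[OF inj_on_\<phi>[OF i] H_plus_maps_to[OF Fi x] UK] .
        then show ?thesis using i x Fi by (simp add: F(1) summand_map_glue)
      qed
      then show ?thesis by blast
    qed
    moreover have "glued_maps \<subseteq> carrier (H_plus S R)"
      using glue_in_H_plus by (auto simp: glued_maps_def)
    ultimately show ?thesis by blast
  qed
  ultimately show "openin (subtopology (H_plus_topology S R) glued_maps)
      {f \<in> topspace (subtopology (H_plus_topology S R) glued_maps). summand_map i f ` C \<subseteq> U}"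
    unfolding top by simp
qed

text \<open>The inverse on the image takes the components of a glued map and applies to each the
  inverse \<open>k i\<close> of \<open>h i\<close>. Its continuity is a matter of single
  coordinates, as the target is a product.\<close>

lemma embedding_map_glue:
  assumes "\<And>i. i \<in> I \<Longrightarrow> embedding_map (T i) (H_plus_topology (K i) (r i)) (h i)"
  shows "embedding_map (product_topology T I) (H_plus_topology S R) (\<lambda>g. glue (\<lambda>i. h i (g i)))"
proof -
  let ?P = "product_topology T I" and ?\<eta> = "\<lambda>g. glue (\<lambda>i. h i (g i))"
  let ?Q = "subtopology (H_plus_topology S R) (?\<eta> ` topspace ?P)"
  let ?H = "\<lambda>i. H_plus_topology (K i) (r i)"
  have "\<exists>k. homeomorphic_maps (T i) (subtopology (?H i) (h i ` topspace (T i))) (h i) k" if "i \<in> I" for i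
    using assms[OF that] by (simp add: embedding_map_def homeomorphic_map_maps)
  then obtain k where k: "\<And>i. i \<in> I \<Longrightarrow>
      homeomorphic_maps (T i) (subtopology (?H i) (h i ` topspace (T i))) (h i) (k i)"
    by metis
  have cont_h: "continuous_map (T i) (?H i) (h i)" if "i \<in> I" for i
    using k[OF that] continuous_map_into_fulltopology by (auto simp: homeomorphic_maps_def)
  have cont_k: "continuous_map (subtopology (?H i) (h i ` topspace (T i))) (T i) (k i)"
    and kh: "\<And>t. t \<in> topspace (T i) \<Longrightarrow> k i (h i t) = t" if "i \<in> I" for i
    using k[OF that] by (auto simp: homeomorphic_maps_def)
  have h_car: "h i (g i) \<in> carrier (H_plus (K i) (r i))" if "g \<in> topspace ?P" "i \<in> I" for g i
    using continuous_map_image_subset_topspace[OF cont_h[OF that(2)]] that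
    by (auto simp: topspace_H_plus_topology)
  have sm: "summand_map i (?\<eta> g) = h i (g i)" if "g \<in> topspace ?P" "i \<in> I" for g i
    using that h_car by (intro summand_map_glue)
  have glued: "?\<eta> ` topspace ?P \<subseteq> glued_maps"
    using h_car unfolding glued_maps_def by blast
  have top_Q: "topspace ?Q = ?\<eta> ` topspace ?P"
    using glue_in_H_plus h_car by (auto simp: topspace_H_plus_topology)
  have cont_\<eta>: "continuous_map ?P (H_plus_topology S R) ?\<eta>"
    by (rule continuous_map_glue_H_plus)
      (rule continuous_map_compose[OF continuous_map_product_projection[of _ I T] cont_h, unfolded o_def])
  have inv: "(\<lambda>i\<in>I. k i (summand_map i (?\<eta> g))) = g" if "g \<in> topspace ?P" for g
  proof
    fix i
    show "(\<lambda>i\<in>I. k i (summand_map i (?\<eta> g))) i = g i"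
      using that sm[OF that] kh by (cases "i \<in> I") auto
  qed
  have "homeomorphic_maps ?P ?Q ?\<eta> (\<lambda>f. \<lambda>i\<in>I. k i (summand_map i f))"
    unfolding homeomorphic_maps_def
  proof (intro conjI ballI)
    show "continuous_map ?P ?Q ?\<eta>"
      using cont_\<eta> by (auto simp: continuous_map_in_subtopology)
    show "continuous_map ?Q ?P (\<lambda>f. \<lambda>i\<in>I. k i (summand_map i f))"
      unfolding continuous_map_componentwise
    proof (intro conjI ballI)
      fix i assume i: "i \<in> I"
      have "continuous_map ?Q (?H i) (summand_map i)"
        using continuous_map_summand_map[OF i] glued by (rule continuous_map_from_subtopology_mono)
      \<comment> \<open>The inverse \<open>k i\<close> is continuous only on the image of
        \<open>h i\<close>, so the components must be shown to land there.\<close>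
      moreover have "summand_map i f \<in> h i ` topspace (T i)" if "f \<in> topspace ?Q" for f
        using that sm i unfolding top_Q by auto
      ultimately have "continuous_map ?Q (subtopology (?H i) (h i ` topspace (T i))) (summand_map i)"
        by (auto simp: continuous_map_in_subtopology)
      from continuous_map_compose[OF this cont_k[OF i]]
      show "continuous_map ?Q (T i) (\<lambda>f. (\<lambda>i\<in>I. k i (summand_map i f)) i)"
        using i by (simp add: o_def)
    qed auto
    show "(\<lambda>i\<in>I. k i (summand_map i (?\<eta> g))) = g" if "g \<in> topspace ?P" for g
      using that by (rule inv)
    show "?\<eta> (\<lambda>i\<in>I. k i (summand_map i f)) = f" if "f \<in> topspace ?Q" for f
    proof -
      \<comment> \<open>Every point of \<open>?Q\<close> is a value of \<open>?\<eta>\<close>, so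
        this inversion law follows from the other one.\<close>
      from that obtain g where "g \<in> topspace ?P" "f = ?\<eta> g" unfolding top_Q by blast
      with inv show ?thesis by metis
    qed
  qed
  then show ?thesis
    unfolding embedding_map_def homeomorphic_map_maps by blast
qed

text \<open>Gluing turns componentwise composition into composition, and \<open>summand_map\<close>
  recovers each \<open>h i (g i)\<close> from the glued map, whence \<open>g i\<close> by
  injectivity of \<open>h i\<close>.\<close>

lemma mon_glue:
  assumes "\<And>i. i \<in> I \<Longrightarrow> h i \<in> mon (G i) (H_plus (K i) (r i))"
  shows "(\<lambda>g. glue (\<lambda>i. h i (g i))) \<in> mon (product_group I G) (H_plus S R)"
proof -
  let ?\<eta> = "\<lambda>g. glue (\<lambda>i. h i (g i))"
  have hom: "h i \<in> hom (G i) (H_plus (K i) (r i))" and inj: "inj_on (h i) (carrier (G i))"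
    if "i \<in> I" for i
    using assms[OF that] by (auto simp: mon_def)
  have h_car: "h i (g i) \<in> carrier (H_plus (K i) (r i))"
    if "g \<in> (\<Pi>\<^sub>E i\<in>I. carrier (G i))" "i \<in> I" for g i
    using that hom_in_carrier[OF hom] by auto
  then have \<eta>_car: "?\<eta> g \<in> carrier (H_plus S R)" if "g \<in> (\<Pi>\<^sub>E i\<in>I. carrier (G i))" for g
    using that by (intro glue_in_H_plus)
  have "?\<eta> (\<lambda>i\<in>I. g i \<otimes>\<^bsub>G i\<^esub> g' i) = ?\<eta> g \<otimes>\<^bsub>H_plus S R\<^esub> ?\<eta> g'"
    if g: "g \<in> (\<Pi>\<^sub>E i\<in>I. carrier (G i))" "g' \<in> (\<Pi>\<^sub>E i\<in>I. carrier (G i))" for g g'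
  proof -
    have "?\<eta> (\<lambda>i\<in>I. g i \<otimes>\<^bsub>G i\<^esub> g' i) = glue (\<lambda>i. compose (K i) (h i (g i)) (h i (g' i)))"
    proof (rule glue_cong)
      fix i assume i: "i \<in> I"
      then have "h i (g i \<otimes>\<^bsub>G i\<^esub> g' i) = h i (g i) \<otimes>\<^bsub>H_plus (K i) (r i)\<^esub> h i (g' i)"
        using hom_mult[OF hom[OF i]] PiE_mem[OF g(1) i] PiE_mem[OF g(2) i] by blast
      then show "h i ((\<lambda>i\<in>I. g i \<otimes>\<^bsub>G i\<^esub> g' i) i) = compose (K i) (h i (g i)) (h i (g' i))"
        using i mult_H_plus[OF h_car[OF g(1) i] h_car[OF g(2) i]] by simp
    qed
    also have "\<dots> = compose S (?\<eta> g) (?\<eta> g')"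
      using h_car[OF g(2)] by (rule glue_compose)
    also have "\<dots> = ?\<eta> g \<otimes>\<^bsub>H_plus S R\<^esub> ?\<eta> g'"
      using \<eta>_car g by (simp add: mult_H_plus)
    finally show ?thesis .
  qed
  moreover have "inj_on ?\<eta> (\<Pi>\<^sub>E i\<in>I. carrier (G i))"
  proof (rule inj_onI)
    fix g g' assume g: "g \<in> (\<Pi>\<^sub>E i\<in>I. carrier (G i))" "g' \<in> (\<Pi>\<^sub>E i\<in>I. carrier (G i))"
      and eq: "?\<eta> g = ?\<eta> g'"
    show "g = g'"
    proof (rule PiE_ext[OF g])
      fix i assume i: "i \<in> I"
      have "h i (g i) = summand_map i (?\<eta> g)" "h i (g' i) = summand_map i (?\<eta> g')"
        using h_car g i by (simp_all add: summand_map_glue)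
      with eq have "h i (g i) = h i (g' i)" by simp
      then show "g i = g' i"
        using inj_onD[OF inj[OF i]] g i by blast
    qed
  qed
  ultimately show ?thesis
    using \<eta>_car by (auto simp: mon_def hom_def)
qed

end

section \<open>The size of the point type\<close>

text \<open>The greatest moved point \<open>m\<close> satisfies \<open>f m \<le> m\<close>, since \<open>f m\<close> is moved, and \<open>m \<le> f m\<close>, since
  the preimage of \<open>m\<close> is moved.\<close>
lemma H_plus_finite_trivial:
  assumes lin: "linear_order_on K r" and "finite K" and f: "f \<in> carrier (H_plus K r)"
  shows "f = (\<lambda>x\<in>K. x)"
proof -
  have bij: "bij_betw f K K" and ext: "f \<in> extensional K"
    using f carrier_H_plus_subset_Bij[of K r] by (auto simp: Bij_def)
  define M where "M = {x \<in> K. f x \<noteq> x}"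
  have "M = {}"
  proof (rule ccontr)
    assume "M \<noteq> {}"
    moreover have "finite M" "M \<subseteq> K" using \<open>finite K\<close> by (auto simp: M_def)
    ultimately obtain m where m: "m \<in> M" "\<And>x. x \<in> M \<Longrightarrow> (x, m) \<in> r"
      using finite_linear_order_on_has_greatest[OF lin] by metis
    then have mK: "m \<in> K" "f m \<noteq> m" by (auto simp: M_def)
    then have fm: "f m \<in> K" using H_plus_maps_to[OF f] by blast
    have inj: "inj_on f K" using bij by (simp add: bij_betw_def)
    have "f m \<in> M"
      using mK fm inj_onD[OF inj, of "f m" m] by (auto simp: M_def)
    then have le: "(f m, m) \<in> r" by (rule m)
    have "m \<in> f ` K" using bij mK(1) by (simp add: bij_betw_def)
    then obtain w where w: "w \<in> K" "f w = m" by blast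
    with mK have "w \<in> M" by (auto simp: M_def)
    then have "(w, m) \<in> r" by (rule m)
    then have "(m, f m) \<in> r"
      using f mK(1) w unfolding in_carrier_H_plus by blast
    moreover have "antisym r"
      using lin by (simp add: linear_order_on_def partial_order_on_def)
    ultimately show False using le mK(2) antisymD by metis
  qed
  with ext show ?thesis by (auto simp: M_def extensional_def fun_eq_iff)
qed

lemma orderly_finite_type_trivial:
  assumes "finite (UNIV :: 'k set)" "orderly TYPE('k) G T"
  shows "carrier G = {\<one>\<^bsub>G\<^esub>}"
proof -
  obtain K :: "'k set" and r h where K: "compact_linearly_ordered_space K r"
    and h: "h \<in> mon G (H_plus K r)" and G: "group G"
    using assms(2) unfolding orderly_def topological_group_def by blast
  have "linear_order_on K r" "finite K"
    using K assms(1) by (auto simp: compact_linearly_ordered_space_def intro: finite_subset)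
  then have "h g = (\<lambda>x\<in>K. x)" if "g \<in> carrier G" for g
    using H_plus_finite_trivial h that by (auto simp: mon_def hom_def Pi_def)
  moreover have "inj_on h (carrier G)" using h by (simp add: mon_def)
  moreover have "\<one>\<^bsub>G\<^esub> \<in> carrier G" using G by (simp add: group.is_monoid monoid.one_closed)
  ultimately have "g = \<one>\<^bsub>G\<^esub>" if "g \<in> carrier G" for g
    using that by (metis inj_onD)
  then show ?thesis using \<open>\<one>\<^bsub>G\<^esub> \<in> carrier G\<close> by blast
qed

text \<open>Multiplying an infinite cardinal by a nonzero cardinal that is not larger leaves it
  unchanged. The empty index set is treated apart because the product is then empty.\<close>

lemma finite_times_infinite_inj:
  assumes "finite I" "infinite (UNIV :: 'k set)"
  obtains \<psi> :: "'i \<times> 'k \<Rightarrow> 'k" where "inj_on \<psi> (I \<times> UNIV)"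
proof (cases "I = {}")
  case True
  with that show ?thesis by auto
next
  case False
  have "\<exists>\<psi> :: 'i \<times> 'k \<Rightarrow> 'k. bij_betw \<psi> (I \<times> UNIV) UNIV"
    using card_of_Times_infinite[OF assms(2) False
        finite_lepoll_infinite[OF assms(2,1), unfolded lepoll_def card_of_ordLeq]]
    by (simp add: card_of_ordIso)
  then show ?thesis using that bij_betw_imp_inj_on by blast
qed

theorem proposition4p9:
  fixes I :: "'i set"
    and G :: "'i \<Rightarrow> ('a, 'b) monoid_scheme"
    and T :: "'i \<Rightarrow> 'a topology"
  assumes "finite I"
    and "\<And>i. i \<in> I \<Longrightarrow> orderly TYPE('k) (G i) (T i)"
  shows "orderly TYPE('k) (product_group I G) (product_topology T I)"
proof -
  have top: "topological_group (product_group I G) (product_topology T I)"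
    using assms(2) by (intro topological_group_product) (auto simp: orderly_def)
  show ?thesis
  proof (cases "finite (UNIV :: 'k set)")
    case True
    then have "carrier (G i) = {\<one>\<^bsub>G i\<^esub>}" if "i \<in> I" for i
      using assms(2)[OF that] by (rule orderly_finite_type_trivial)
    then have "(\<Pi>\<^sub>E i\<in>I. carrier (G i)) = (\<Pi>\<^sub>E i\<in>I. {\<one>\<^bsub>G i\<^esub>})"
      by (rule PiE_cong)
    also have "\<dots> = {\<lambda>i\<in>I. \<one>\<^bsub>G i\<^esub>}"
      by (auto simp: PiE_iff extensional_def fun_eq_iff)
    finally show ?thesis
      using top by (intro orderly_trivial_group) simp_all
  next
    case False
    obtain \<psi> :: "'i \<times> 'k \<Rightarrow> 'k" where \<psi>: "inj_on \<psi> (I \<times> UNIV)"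
      using finite_times_infinite_inj[OF assms(1) False] .
    obtain e :: "'i \<Rightarrow> nat" where e: "inj_on e I"
      using finite_imp_inj_to_nat_seg[OF assms(1)] by blast
    have "\<forall>i\<in>I. \<exists>K :: 'k set. \<exists>r h. compact_linearly_ordered_space K r \<and>
        h \<in> mon (G i) (H_plus K r) \<and> embedding_map (T i) (H_plus_topology K r) h"
      using assms(2) unfolding orderly_def by blast
    then obtain K :: "'i \<Rightarrow> 'k set" and r h where
      K: "\<And>i. i \<in> I \<Longrightarrow> compact_linearly_ordered_space (K i) (r i)" and
      h: "\<And>i. i \<in> I \<Longrightarrow> h i \<in> mon (G i) (H_plus (K i) (r i))"
        "\<And>i. i \<in> I \<Longrightarrow> embedding_map (T i) (H_plus_topology (K i) (r i)) (h i)"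
      by metis
    \<comment> \<open>The common type of the sum is now \<open>'k\<close> itself, and joint
      injectivity of the placements is injectivity of \<open>\<psi>\<close> on pairs.\<close>
    interpret chain_sum I K r "\<lambda>i x. \<psi> (i, x)" e
      using assms(1) e K inj_on_eq_iff[OF \<psi>] by unfold_locales auto
    show ?thesis
      using top compact_linearly_ordered_sum mon_glue[of h G, OF h(1)] embedding_map_glue[of T h, OF h(2)]
      unfolding orderly_def by blast
  qed
qed

end
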